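(* Let $I_{11},I_{22}>0$, $\mathcal{D}\ge 0$ and $I_{13},I_{23}\in\mathbb{R}$ with $(I_{13},I_{23})\neq(0,0)$. Consider the system on $\mathbb{R}^5=\{(\omega_1,\omega_2,\gamma_1,\gamma_2,\gamma_3)\}$ (Chaplygin ball with Suslov's constraint in the absence of an external field) $$\widehat{\mathbf I}\begin{pmatrix}\dot\omega_1\\ \dot\omega_2\end{pmatrix}=\begin{pmatrix}-(I_{13}\omega_1+I_{23}\omega_2)\omega_2\\ (I_{13}\omega_1+I_{23}\omega_2)\omega_1\end{pmatrix},$$ $$\dot\gamma_1=-\gamma_3\omega_2,\quad \dot\gamma_2=\gamma_3\omega_1,\quad \dot\gamma_3=\gamma_1\omega_2-\gamma_2\omega_1,$$ where $$\widehat{\mathbf I}=\begin{pmatrix}I_{11}+\mathcal{D}(\gamma_2^2+\gamma_3^2)&-\mathcal{D}\gamma_1\gamma_2\\ -\mathcal{D}\gamma_1\gamma_2&I_{22}+\mathcal{D}(\gamma_1^2+\gamma_3^2)\end{pmatrix}.$$ Then this system possesses the singular invariant measure $$\mu=(I_{13}\omega_1+I_{23}\omega_2)^{-1}\,d\omega_1\,d\omega_2\,d\gamma_1\,d\gamma_2\,d\gamma_3 .$$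
   Context: For a system $\dot{\boldsymbol x}=\boldsymbol v(\boldsymbol x)$, the form $\rho(\boldsymbol x)\,dx_1\cdots dx_n$ is called an invariant measure if the density $\rho$ satisfies the Liouville equation $\operatorname{div}(\rho\boldsymbol v)=0$ wherever $\rho$ is smooth. The density is allowed to change sign. The measure is called singular when its density has singularities, here on the set $I_{13}\omega_1+I_{23}\omega_2=0$; the Liouville equation is required on the complement of this set. *)

theory Defs
  imports "HOL-Analysis.Analysis"
begin

definition partial_deriv :: "'n::finite \<Rightarrow> (real^'n \<Rightarrow> real) \<Rightarrow> real^'n \<Rightarrow> real" where
  "partial_deriv i f x = frechet_derivative f (at x) (axis i 1)"

definition divergence :: "(real^'n \<Rightarrow> real^'n) \<Rightarrow> real^'n \<Rightarrow> real" where
  "divergence F x = (\<Sum>i\<in>UNIV. partial_deriv i (\<lambda>y. F y $ i) x)"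

(* Both smoothness predicates are meant for open U. *)
primrec Ck_on :: "nat \<Rightarrow> (real^'n) set \<Rightarrow> (real^'n \<Rightarrow> real) \<Rightarrow> bool" where
  "Ck_on 0 U f \<longleftrightarrow> continuous_on U f"
| "Ck_on (Suc k) U f \<longleftrightarrow>
     (\<forall>x\<in>U. f differentiable (at x)) \<and> (\<forall>i. Ck_on k U (partial_deriv i f))"

definition smooth_on :: "(real^'n) set \<Rightarrow> (real^'n \<Rightarrow> real) \<Rightarrow> bool" where
  "smooth_on U f \<longleftrightarrow> (\<forall>k. Ck_on k U f)"

(* Differentiability is required because frechet_derivative is arbitrary without it. *)
definition liouville_at ::
  "(real^'n \<Rightarrow> real^'n) \<Rightarrow> (real^'n \<Rightarrow> real) \<Rightarrow> real^'n \<Rightarrow> bool" where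
  "liouville_at v \<rho> x \<longleftrightarrow>
     (\<lambda>y. \<rho> y *\<^sub>R v y) differentiable (at x) \<and> divergence (\<lambda>y. \<rho> y *\<^sub>R v y) x = 0"

(* The values of \<rho> on S are irrelevant.  A point of S is a genuine singularity: whatever
   values are chosen on S, \<rho> does not become smooth near that point. *)
definition singular_point ::
  "(real^'n) set \<Rightarrow> (real^'n \<Rightarrow> real) \<Rightarrow> real^'n \<Rightarrow> bool" where
  "singular_point S \<rho> x \<longleftrightarrow>
     \<not> (\<exists>U g. open U \<and> x \<in> U \<and> smooth_on U g \<and> (\<forall>y\<in>U - S. g y = \<rho> y))"

(* The form \<rho> dx1 ... dxn, represented by its (possibly sign-changing) density \<rho>, is an
   invariant measure of x' = v x that is singular precisely on S. *)
definition singular_invariant_measure ::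
  "(real^'n \<Rightarrow> real^'n) \<Rightarrow> (real^'n \<Rightarrow> real) \<Rightarrow> (real^'n) set \<Rightarrow> bool" where
  "singular_invariant_measure v \<rho> S \<longleftrightarrow>
     closed S \<and> S \<noteq> {} \<and>
     smooth_on (- S) \<rho> \<and> (\<forall>x\<in>S. singular_point S \<rho> x) \<and>
     (\<forall>x\<in>- S. liouville_at v \<rho> x)"

definition inertia_hat :: "real \<Rightarrow> real \<Rightarrow> real \<Rightarrow> real \<Rightarrow> real \<Rightarrow> real \<Rightarrow> real^2^2" where
  "inertia_hat I11 I22 D \<gamma>1 \<gamma>2 \<gamma>3 =
     vector [vector [I11 + D * (\<gamma>2\<^sup>2 + \<gamma>3\<^sup>2), - D * \<gamma>1 * \<gamma>2],
             vector [- D * \<gamma>1 * \<gamma>2, I22 + D * (\<gamma>1\<^sup>2 + \<gamma>3\<^sup>2)]]"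

(* The equations of motion, as a relation between the state
   x = (\<omega>1, \<omega>2, \<gamma>1, \<gamma>2, \<gamma>3) and its velocity x'. *)
definition chaplygin_suslov ::
  "real \<Rightarrow> real \<Rightarrow> real \<Rightarrow> real \<Rightarrow> real \<Rightarrow> real^5 \<Rightarrow> real^5 \<Rightarrow> bool" where
  "chaplygin_suslov I11 I22 I13 I23 D x x' \<longleftrightarrow>
     (let \<omega>1 = x $ 1; \<omega>2 = x $ 2; \<gamma>1 = x $ 3; \<gamma>2 = x $ 4; \<gamma>3 = x $ 5 in
        inertia_hat I11 I22 D \<gamma>1 \<gamma>2 \<gamma>3 *v vector [x' $ 1, x' $ 2] =
          vector [- (I13 * \<omega>1 + I23 * \<omega>2) * \<omega>2, (I13 * \<omega>1 + I23 * \<omega>2) * \<omega>1] \<and>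
        x' $ 3 = - \<gamma>3 * \<omega>2 \<and>
        x' $ 4 = \<gamma>3 * \<omega>1 \<and>
        x' $ 5 = \<gamma>1 * \<omega>2 - \<gamma>2 * \<omega>1)"

end

(* Write s = I13 * omega1 + I23 * omega2. Solving the first two equations gives velocities divisible
   by s, so multiplying by the density 1/s makes the first two components linear in omega:
   -(c * omega2 + b * omega1) / Delta and (a * omega1 + b * omega2) / Delta, with a, b, c the entries
   of the inertia matrix and Delta its determinant.  Their divergence is -b / Delta + b / Delta = 0,
   and gamma_i' does not depend on gamma_i. *)

theory Submission imports Defs begin

section \<open>Partial derivatives\<close>

lemma exhaust_5:
  fixes x :: 5
  shows "x = 1 \<or> x = 2 \<or> x = 3 \<or> x = 4 \<or> x = 5"
proof (induct x)
  case (of_int z)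
  \<comment> \<open>The type \<open>5\<close> consists of residues, so the value
    \<open>z = 0\<close> is the index \<open>5\<close>.\<close>
  then have "z = 0 \<or> z = 1 \<or> z = 2 \<or> z = 3 \<or> z = 4" by fastforce
  then show ?case by auto
qed

lemma forall_5: "(\<forall>i::5. P i) \<longleftrightarrow> P 1 \<and> P 2 \<and> P 3 \<and> P 4 \<and> P 5"
  by (metis exhaust_5)

lemma UNIV_5: "UNIV = {1, 2, 3, 4, 5::5}"
  using exhaust_5 by auto

lemma sum_5: "sum f (UNIV::5 set) = f 1 + f 2 + f 3 + f 4 + f 5"
  unfolding UNIV_5 by (simp add: ac_simps)

lemma differentiable_vec_nth_iff:
  fixes f :: "'a::euclidean_space \<Rightarrow> real^'n"
  shows "f differentiable (at x) \<longleftrightarrow> (\<forall>i. (\<lambda>y. f y $ i) differentiable (at x))"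
  by (subst differentiable_componentwise_within) (auto simp: Basis_vec_def inner_axis)

lemma partial_deriv_has_derivative:
  "(f has_derivative f') (at x) \<Longrightarrow> partial_deriv i f x = f' (axis i 1)"
  unfolding partial_deriv_def by (simp flip: frechet_derivative_at)

text \<open>The chain rule along the line through \<open>x\<close> in direction
  \<open>axis i 1\<close> reduces the computation to a derivative in one variable; uniqueness of
  that derivative identifies the two linear maps, evaluated at 1.\<close>

lemma partial_deriv_eqI:
  assumes "f differentiable (at x)"
    and "((\<lambda>t. f (x + t *\<^sub>R axis i 1)) has_real_derivative d) (at 0)"
  shows "partial_deriv i f x = d"
proof -
  let ?F = "frechet_derivative f (at x)" and ?p = "\<lambda>t::real. x + t *\<^sub>R axis i 1"
  have F: "(f has_derivative ?F) (at x)"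
    using assms(1) by (simp add: frechet_derivative_works)
  have p: "(?p has_derivative (\<lambda>t. t *\<^sub>R axis i 1)) (at 0)"
    by (auto intro!: derivative_eq_intros)
  have "((\<lambda>t. f (?p t)) has_derivative (\<lambda>t. ?F (t *\<^sub>R axis i 1))) (at 0)"
    using has_derivative_compose[OF p, of f ?F] F by simp
  then have "(\<lambda>t. ?F (t *\<^sub>R axis i 1)) = (\<lambda>t. d * t)"
    using assms(2) unfolding has_field_derivative_def by (rule has_derivative_unique)
  from fun_cong[OF this, of 1] show ?thesis
    by (simp add: partial_deriv_def)
qed

lemma differentiable_transform_open:
  assumes "f differentiable (at x)" "open U" "x \<in> U" "\<And>y. y \<in> U \<Longrightarrow> f y = g y"
  shows "g differentiable (at x)"
  using assms has_derivative_transform_within_open unfolding differentiable_def by blast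

lemma partial_deriv_transform_open:
  assumes "f differentiable (at x)" "open U" "x \<in> U" "\<And>y. y \<in> U \<Longrightarrow> f y = g y"
  shows "partial_deriv i f x = partial_deriv i g x"
  using frechet_derivative_transform_within_open[OF assms] by (simp add: partial_deriv_def)

text \<open>On an open set, agreeing functions have agreeing partial derivatives, so the induction
  descends. This allows a partial derivative to be replaced by its closed form on
  \<open>U\<close>.\<close>

lemma Ck_on_cong:
  assumes "open U" "\<And>y. y \<in> U \<Longrightarrow> f y = g y" "Ck_on k U f"
  shows "Ck_on k U g"
  using assms(2,3)
proof (induction k arbitrary: f g)
  case 0
  then show ?case by (simp cong: continuous_on_cong)
next
  case (Suc k)
  have diff: "\<forall>x\<in>U. f differentiable (at x)" and Ck: "\<And>i. Ck_on k U (partial_deriv i f)"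
    using Suc.prems by auto
  have "Ck_on k U (partial_deriv i g)" for i
    using Suc.IH[OF _ Ck] partial_deriv_transform_open diff \<open>open U\<close> Suc.prems(1) by metis
  moreover have "\<forall>x\<in>U. g differentiable (at x)"
    using differentiable_transform_open diff \<open>open U\<close> Suc.prems(1) by metis
  ultimately show ?case by simp
qed

section \<open>The reciprocal of a linear form\<close>

lemma open_inner_nonzero: "open {y::real^'n. a \<bullet> y \<noteq> 0}"
  by (intro open_Collect_neq continuous_intros)

text \<open>The family over all \<open>c\<close> and \<open>m\<close> is closed under partial
  derivatives: the \<open>i\<close>-th one replaces \<open>c\<close> by
  \<open>- c * m * a $ i\<close> and \<open>m\<close> by \<open>m + 1\<close>. Hence both vary in
  the induction.\<close>

lemma Ck_on_inverse_inner_power: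
  "Ck_on k {y::real^'n. a \<bullet> y \<noteq> 0} (\<lambda>y. c * inverse (a \<bullet> y) ^ m)"
proof (induction k arbitrary: c m)
  case 0
  show ?case by (auto intro!: continuous_intros)
next
  case (Suc k)
  let ?U = "{y::real^'n. a \<bullet> y \<noteq> 0}" and ?f = "\<lambda>y::real^'n. c * inverse (a \<bullet> y) ^ m"
  have der: "(?f has_derivative (\<lambda>h. - c * real m * inverse (a \<bullet> x) ^ Suc m * (a \<bullet> h))) (at x)"
    if "x \<in> ?U" for x
  proof -
    have "((\<lambda>s. c * inverse s ^ m) has_real_derivative - c * real m * inverse (a \<bullet> x) ^ Suc m)
        (at (a \<bullet> x))"
      \<comment> \<open>The power rule yields the exponent \<open>m - 1\<close> in truncated
        subtraction, so \<open>m = 0\<close>, where both sides vanish, is split off.\<close>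
      using that by (auto intro!: DERIV_cong[OF DERIV_cmult[OF DERIV_power[OF DERIV_inverse]]])
        (cases m; simp)
    moreover have "((\<lambda>y. a \<bullet> y) has_derivative (\<lambda>h. a \<bullet> h)) (at x)"
      by (auto intro!: derivative_eq_intros)
    ultimately show ?thesis
      unfolding has_field_derivative_def by (rule has_derivative_compose[rotated])
  qed
  have "Ck_on k ?U (partial_deriv i ?f)" for i
  proof (rule Ck_on_cong[OF open_inner_nonzero])
    show "Ck_on k ?U (\<lambda>y. (- c * real m * a $ i) * inverse (a \<bullet> y) ^ Suc m)"
      by (rule Suc.IH)
  qed (simp add: partial_deriv_has_derivative[OF der] inner_axis)
  then show ?case
    using der by (auto simp: differentiable_def)
qed

lemma smooth_on_inverse_inner: "smooth_on {y::real^'n. a \<bullet> y \<noteq> 0} (\<lambda>y. inverse (a \<bullet> y))"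
  unfolding smooth_on_def using Ck_on_inverse_inner_power[of _ a 1 1] by simp

text \<open>Even a continuous extension is impossible: times the linear form it would be 1 off the
  hyperplane and 0 on it.\<close>
lemma singular_point_inverse_inner:
  fixes a :: "real^'n"
  assumes "a \<noteq> 0" "a \<bullet> x = 0"
  shows "singular_point {y. a \<bullet> y = 0} (\<lambda>y. inverse (a \<bullet> y)) x"
  unfolding singular_point_def
proof safe
  fix U g
  assume U: "open U" "x \<in> U" and "smooth_on U g"
    and g: "\<forall>y\<in>U - {y. a \<bullet> y = 0}. g y = inverse (a \<bullet> y)"
  \<comment> \<open>Approach \<open>x\<close> along the normal \<open>a\<close>: since
    \<open>a \<bullet> x = 0\<close>, the form takes the value \<open>t * (a \<bullet> a)\<close>
    there, nonzero for \<open>t \<noteq> 0\<close>.\<close>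
  have g_line: "g (x + t *\<^sub>R a) * (t * (a \<bullet> a)) = 1" if "x + t *\<^sub>R a \<in> U" "t \<noteq> 0" for t
  proof -
    have "g (x + t *\<^sub>R a) = inverse (t * (a \<bullet> a))"
      using g assms that by (simp add: inner_add_right)
    then show ?thesis
      using assms that by (simp add: field_simps)
  qed
  have "continuous_on U g"
    using \<open>smooth_on U g\<close> Ck_on.simps(1) unfolding smooth_on_def by blast
  then have "isCont g x"
    using U continuous_on_eq_continuous_at by blast
  have line: "((\<lambda>t::real. x + t *\<^sub>R a) \<longlongrightarrow> x) (at 0)"
    by (auto intro!: tendsto_eq_intros)
  have "((\<lambda>t. g (x + t *\<^sub>R a) * (a \<bullet> (x + t *\<^sub>R a))) \<longlongrightarrow> g x * (a \<bullet> x)) (at 0)"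
    by (intro tendsto_intros isCont_tendsto_compose[OF \<open>isCont g x\<close>] line)
  moreover have "\<forall>\<^sub>F t in at 0. g (x + t *\<^sub>R a) * (a \<bullet> (x + t *\<^sub>R a)) = 1"
    using topological_tendstoD[OF line U] eventually_neq_at_within[of 0]
    by eventually_elim (use assms g_line in \<open>simp add: inner_add_right\<close>)
  ultimately have "((\<lambda>t::real. 1::real) \<longlongrightarrow> 0) (at 0)"
    unfolding assms(2) mult_zero_right by (rule Lim_transform_eventually)
  then show False
    by (simp add: tendsto_const_iff)
qed

section \<open>The vector field\<close>

definition inertia_det :: "real \<Rightarrow> real \<Rightarrow> real \<Rightarrow> real^5 \<Rightarrow> real" where
  "inertia_det I11 I22 D x =
     (I11 + D * ((x $ 4)\<^sup>2 + (x $ 5)\<^sup>2)) * (I22 + D * ((x $ 3)\<^sup>2 + (x $ 5)\<^sup>2)) - (D * x $ 3 * x $ 4)\<^sup>2"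

text \<open>The subtracted square cancels against the term \<open>D\<^sup>2 * p * q\<close> of the
  product; what remains is \<open>I11 * I22\<close> plus nonnegative terms. Thus the inertia matrix
  is invertible at every state.\<close>

lemma inertia_det_pos:
  assumes "I11 > 0" "I22 > 0" "D \<ge> 0"
  shows "inertia_det I11 I22 D x > 0"
proof -
  define p q r where "p = (x $ 3)\<^sup>2" and "q = (x $ 4)\<^sup>2" and "r = (x $ 5)\<^sup>2"
  have nn: "p \<ge> 0" "q \<ge> 0" "r \<ge> 0"
    by (simp_all add: p_def q_def r_def)
  have "inertia_det I11 I22 D x =
      I11 * I22 + I11 * (D * (p + r)) + I22 * (D * (q + r)) + D\<^sup>2 * (r * (p + q + r))"
    unfolding inertia_det_def p_def q_def r_def by (simp add: algebra_simps power2_eq_square)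
  moreover have "I11 * I22 > 0" "I11 * (D * (p + r)) \<ge> 0" "I22 * (D * (q + r)) \<ge> 0"
    "D\<^sup>2 * (r * (p + q + r)) \<ge> 0"
    using assms nn by simp_all
  ultimately show ?thesis by linarith
qed

text \<open>The first angular acceleration with the factor
  \<open>I13 * \<omega>1 + I23 * \<omega>2\<close> removed. It extends density times velocity
  smoothly across the singular hyperplane.\<close>

definition omega1_rate :: "real \<Rightarrow> real \<Rightarrow> real \<Rightarrow> real^5 \<Rightarrow> real" where
  "omega1_rate I11 I22 D x =
     (D * x $ 3 * x $ 4 * x $ 1 - (I22 + D * ((x $ 3)\<^sup>2 + (x $ 5)\<^sup>2)) * x $ 2) / inertia_det I11 I22 D x"

definition omega2_rate :: "real \<Rightarrow> real \<Rightarrow> real \<Rightarrow> real^5 \<Rightarrow> real" where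
  "omega2_rate I11 I22 D x =
     ((I11 + D * ((x $ 4)\<^sup>2 + (x $ 5)\<^sup>2)) * x $ 1 - D * x $ 3 * x $ 4 * x $ 2) / inertia_det I11 I22 D x"

definition suslov_field ::
  "real \<Rightarrow> real \<Rightarrow> real \<Rightarrow> real \<Rightarrow> real \<Rightarrow> real^5 \<Rightarrow> real^5" where
  "suslov_field I11 I22 I13 I23 D x = (\<chi> i.
     if i = 1 then (I13 * x $ 1 + I23 * x $ 2) * omega1_rate I11 I22 D x
     else if i = 2 then (I13 * x $ 1 + I23 * x $ 2) * omega2_rate I11 I22 D x
     else if i = 3 then - x $ 5 * x $ 2
     else if i = 4 then x $ 5 * x $ 1
     else x $ 3 * x $ 2 - x $ 4 * x $ 1)"

lemma suslov_field_nth [simp]: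
  "suslov_field I11 I22 I13 I23 D x $ 1 = (I13 * x $ 1 + I23 * x $ 2) * omega1_rate I11 I22 D x"
  "suslov_field I11 I22 I13 I23 D x $ 2 = (I13 * x $ 1 + I23 * x $ 2) * omega2_rate I11 I22 D x"
  "suslov_field I11 I22 I13 I23 D x $ 3 = - x $ 5 * x $ 2"
  "suslov_field I11 I22 I13 I23 D x $ 4 = x $ 5 * x $ 1"
  "suslov_field I11 I22 I13 I23 D x $ 5 = x $ 3 * x $ 2 - x $ 4 * x $ 1"
  by (simp_all add: suslov_field_def)

section \<open>Solving the equations of motion for the velocities\<close>

lemma cramer_2:
  fixes a b c d e f u v :: real
  assumes "a * d - b * c \<noteq> 0"
  shows "a * u + b * v = e \<and> c * u + d * v = f \<longleftrightarrow>
    u = (d * e - b * f) / (a * d - b * c) \<and> v = (a * f - c * e) / (a * d - b * c)"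
    (is "?L \<longleftrightarrow> ?R")
proof
  assume ?L
  then have "u * (a * d - b * c) = d * e - b * f" "v * (a * d - b * c) = a * f - c * e"
    by (auto simp: algebra_simps)
  then show ?R
    using assms by (simp add: eq_divide_eq)
next
  assume ?R
  then have "a * u + b * v = (a * (d * e - b * f) + b * (a * f - c * e)) / (a * d - b * c)"
    "c * u + d * v = (c * (d * e - b * f) + d * (a * f - c * e)) / (a * d - b * c)"
    by (simp_all add: add_divide_distrib)
  moreover have "a * (d * e - b * f) + b * (a * f - c * e) = e * (a * d - b * c)"
    "c * (d * e - b * f) + d * (a * f - c * e) = f * (a * d - b * c)"
    by (simp_all add: algebra_simps)
  ultimately show ?L
    using assms by simp
qed

lemma chaplygin_suslov_iff:
  assumes "I11 > 0" "I22 > 0" "D \<ge> 0"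
  shows "chaplygin_suslov I11 I22 I13 I23 D x x' \<longleftrightarrow> x' = suslov_field I11 I22 I13 I23 D x"
proof -
  \<comment> \<open>The sign is absorbed into \<open>b\<close>, so that the matrix has rows
    \<open>(a, b)\<close> and \<open>(b, c)\<close>.\<close>
  define a b c s where "a = I11 + D * ((x $ 4)\<^sup>2 + (x $ 5)\<^sup>2)" and "b = - D * x $ 3 * x $ 4"
    and "c = I22 + D * ((x $ 3)\<^sup>2 + (x $ 5)\<^sup>2)" and "s = I13 * x $ 1 + I23 * x $ 2"
  have det: "inertia_det I11 I22 D x = a * c - b * b"
    by (simp add: inertia_det_def a_def b_def c_def power2_eq_square)
  have rates: "omega1_rate I11 I22 D x = (- (c * x $ 2) - b * x $ 1) / (a * c - b * b)"
    "omega2_rate I11 I22 D x = (a * x $ 1 + b * x $ 2) / (a * c - b * b)"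
    unfolding omega1_rate_def omega2_rate_def det
    by (rule arg_cong2[where f = "(/)"]; simp add: a_def b_def c_def)+
  have "a * c - b * b \<noteq> 0"
    using inertia_det_pos[OF assms, of x] det by simp
  from cramer_2[OF this, of "x' $ 1" "x' $ 2" "- s * x $ 2" "s * x $ 1"]
  have "a * x' $ 1 + b * x' $ 2 = - s * x $ 2 \<and> b * x' $ 1 + c * x' $ 2 = s * x $ 1 \<longleftrightarrow>
    x' $ 1 = s * omega1_rate I11 I22 D x \<and> x' $ 2 = s * omega2_rate I11 I22 D x"
    by (simp add: rates algebra_simps)
  then show ?thesis
    unfolding chaplygin_suslov_def Let_def
    by (simp add: vec_eq_iff forall_2 forall_5 inertia_hat_def matrix_vector_mult_def sum_2
        b_def flip: a_def c_def s_def)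
qed

section \<open>The Liouville equation off the hyperplane\<close>

lemma differentiable_omega_rate:
  assumes "I11 > 0" "I22 > 0" "D \<ge> 0"
  shows "omega1_rate I11 I22 D differentiable (at x)" "omega2_rate I11 I22 D differentiable (at x)"
proof -
  have nth: "(\<lambda>y. y $ i) differentiable (at x)" for i :: 5
    by (intro bounded_linear_imp_differentiable bounded_linear_vec_nth)
  have "inertia_det I11 I22 D differentiable (at x)"
    unfolding inertia_det_def[abs_def] by (intro derivative_intros nth)
  then show "omega1_rate I11 I22 D differentiable (at x)" "omega2_rate I11 I22 D differentiable (at x)"
    unfolding omega1_rate_def[abs_def] omega2_rate_def[abs_def]
    using inertia_det_pos[OF assms, of x]
    by (auto intro!: derivative_intros nth simp: less_imp_neq[symmetric])
qed

text \<open>The determinant depends on \<gamma> only, so each rate is linear in \<omega> and its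
  derivative is a coefficient over the determinant. The two values are opposite because the inertia
  matrix is symmetric.\<close>

lemma partial_deriv_omega_rate:
  assumes "I11 > 0" "I22 > 0" "D \<ge> 0"
  shows "partial_deriv 1 (omega1_rate I11 I22 D) x = D * x $ 3 * x $ 4 / inertia_det I11 I22 D x"
    "partial_deriv 2 (omega2_rate I11 I22 D) x = - (D * x $ 3 * x $ 4) / inertia_det I11 I22 D x"
  using inertia_det_pos[OF assms, of x]
  by (auto intro!: partial_deriv_eqI differentiable_omega_rate[OF assms] derivative_eq_intros
      simp: omega1_rate_def omega2_rate_def inertia_det_def axis_def)

lemma liouville_at_suslov_field:
  assumes "I11 > 0" "I22 > 0" "D \<ge> 0" and x: "I13 * x $ 1 + I23 * x $ 2 \<noteq> 0"
  shows "liouville_at (suslov_field I11 I22 I13 I23 D) (\<lambda>x. inverse (I13 * x $ 1 + I23 * x $ 2)) x"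
proof -
  note pos = assms(1-3)
  define F where "F y = inverse (I13 * y $ 1 + I23 * y $ 2) *\<^sub>R suslov_field I11 I22 I13 I23 D y"
    for y :: "real^5"
  let ?U = "{y::real^5. I13 * y $ 1 + I23 * y $ 2 \<noteq> 0}"
  have U: "open ?U" "x \<in> ?U"
    using x by (auto intro!: open_Collect_neq continuous_intros)
  have nth: "(\<lambda>y. y $ i) differentiable (at x)" for i :: 5
    by (intro bounded_linear_imp_differentiable bounded_linear_vec_nth)
  \<comment> \<open>Only on \<open>?U\<close> do these agree: where the form vanishes,
    \<open>inverse 0 = 0\<close> makes \<open>F\<close> zero. Openness of \<open>?U\<close> then
    transfers the derivatives at \<open>x\<close>.\<close>
  have F1: "omega1_rate I11 I22 D y = F y $ 1" and F2: "omega2_rate I11 I22 D y = F y $ 2"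
    if "y \<in> ?U" for y
    using that by (simp_all add: F_def)
  have diff: "(\<lambda>y. F y $ i) differentiable (at x)" for i
  proof -
    have "(\<lambda>y. F y $ 1) differentiable (at x)"
      using differentiable_omega_rate(1)[OF pos] U F1 by (rule differentiable_transform_open)
    moreover have "(\<lambda>y. F y $ 2) differentiable (at x)"
      using differentiable_omega_rate(2)[OF pos] U F2 by (rule differentiable_transform_open)
    moreover have "(\<lambda>y. F y $ 3) differentiable (at x)" "(\<lambda>y. F y $ 4) differentiable (at x)"
      "(\<lambda>y. F y $ 5) differentiable (at x)"
      using x by (auto simp: F_def intro!: derivative_intros nth)
    ultimately show ?thesis
      using exhaust_5[of i] by auto
  qed
  have "partial_deriv 1 (\<lambda>y. F y $ 1) x = D * x $ 3 * x $ 4 / inertia_det I11 I22 D x"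
    using partial_deriv_transform_open[OF differentiable_omega_rate(1)[OF pos] U F1]
      partial_deriv_omega_rate(1)[OF pos] by metis
  moreover have "partial_deriv 2 (\<lambda>y. F y $ 2) x = - (D * x $ 3 * x $ 4) / inertia_det I11 I22 D x"
    using partial_deriv_transform_open[OF differentiable_omega_rate(2)[OF pos] U F2]
      partial_deriv_omega_rate(2)[OF pos] by metis
  \<comment> \<open>Neither the density nor the velocity of a \<gamma>-coordinate involves that
    coordinate, so the component is constant along its own axis.\<close>
  moreover have "partial_deriv i (\<lambda>y. F y $ i) x = 0" if "i \<in> {3, 4, 5}" for i
    by (rule partial_deriv_eqI[OF diff]) (use that in \<open>auto simp: F_def axis_def\<close>)
  ultimately have "divergence F x = 0"
    by (simp add: divergence_def sum_5)
  moreover have "F differentiable (at x)"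
    using diff by (simp add: differentiable_vec_nth_iff)
  ultimately show ?thesis
    by (simp add: liouville_at_def F_def[abs_def])
qed

theorem mainTheorem2:
  fixes I11 I22 I13 I23 D :: real
  assumes "I11 > 0" and "I22 > 0" and "D \<ge> 0" and "(I13, I23) \<noteq> (0, 0)"
  shows "\<exists>v :: real^5 \<Rightarrow> real^5.
           (\<forall>x x'. chaplygin_suslov I11 I22 I13 I23 D x x' \<longleftrightarrow> x' = v x) \<and>
           singular_invariant_measure v
             (\<lambda>x. inverse (I13 * x $ 1 + I23 * x $ 2))
             {x. I13 * x $ 1 + I23 * x $ 2 = 0}"
proof (intro exI conjI allI)
  show "chaplygin_suslov I11 I22 I13 I23 D x x' \<longleftrightarrow> x' = suslov_field I11 I22 I13 I23 D x" for x x'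
    using assms(1-3) by (rule chaplygin_suslov_iff)
  \<comment> \<open>The normal of the singular hyperplane; it turns the form into
    \<open>a \<bullet> x\<close>, and the hypothesis on \<open>I13\<close> and \<open>I23\<close>
    into \<open>a \<noteq> 0\<close>.\<close>
  define a :: "real^5" where "a = I13 *\<^sub>R axis 1 1 + I23 *\<^sub>R axis 2 1"
  have a: "I13 * x $ 1 + I23 * x $ 2 = a \<bullet> x" for x
    by (simp add: a_def inner_add_left inner_axis')
  have "a $ 1 = I13" "a $ 2 = I23"
    by (simp_all add: a_def axis_def)
  with assms(4) have "a \<noteq> 0"
    by auto
  have "closed {x. a \<bullet> x = 0}"
    by (rule closed_hyperplane)
  moreover have "{x. a \<bullet> x = 0} \<noteq> {}"
    using inner_zero_right by blast
  moreover have "- {x. a \<bullet> x = 0} = {x. a \<bullet> x \<noteq> 0}"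
    by auto
  ultimately show "singular_invariant_measure (suslov_field I11 I22 I13 I23 D)
      (\<lambda>x. inverse (I13 * x $ 1 + I23 * x $ 2)) {x. I13 * x $ 1 + I23 * x $ 2 = 0}"
    using smooth_on_inverse_inner[of a] singular_point_inverse_inner[OF \<open>a \<noteq> 0\<close>]
      liouville_at_suslov_field[OF assms(1-3), of I13 _ I23]
    unfolding singular_invariant_measure_def a by auto
qed

end
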